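(* Let $\Gamma\subset\mathbb R$ be an additive subgroup containing $\mathbb Z$. Let $\rho,\mu>0$ and $\gamma,\omega\in\mathbb C$. If $\Gamma$ contains $\rho$ and $\mu$, then $\mathcal E_{\rho,\mu,\omega}^{\gamma}$ belongs to the kernel-norm completion of $\mathcal S_{\Gamma,T}^{\mathrm{fin}}$, and $$\mathcal E_{\rho,\mu,\omega}^{\gamma}=\sum_{n=0}^{\infty}\frac{(\gamma)_n\omega^n}{n!}J^{\mu+\rho n},$$ with absolute convergence in the kernel norm on every finite interval.
   Context: Fix $T>0$ (the length of the finite interval $[0,T]$). For $\rho,\mu>0$ and $\gamma,z\in\mathbb C$, $E_{\rho,\mu}^{\gamma}(z)=\sum_{n\ge0}\frac{(\gamma)_n}{n!\,\Gamma(\rho n+\mu)}z^n$ (three-parameter Mittag--Leffler function; $(\gamma)_n$ Pochhammer symbol, $\Gamma(\cdot)$ the gamma function), and the Prabhakar integral is the convolution operator $(\mathcal E_{\rho,\mu,\omega}^{\gamma}f)(t)=\int_0^t(t-s)^{\mu-1}E_{\rho,\mu}^{\gamma}(\omega(t-s)^\rho)f(s)\,ds$. For $k\in L^1(0,T)$, $(V_kf)(t)=\int_0^tk(t-s)f(s)\,ds$; for $\beta>0$, $h_\beta(t)=t^{\beta-1}/\Gamma(\beta)$ and $J^\beta=V_{h_\beta}$. $\mathcal S_{\Gamma,T}^{\mathrm{fin}}$ is the complex span of $\{J^\beta:\beta\in\Gamma,\ \beta>0\}$. The kernel norm of a convolution operator is $\|V_k\|_{\mathrm{ker}}=\|k\|_{L^1(0,T)}$;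 the kernel-norm completion of $\mathcal S_{\Gamma,T}^{\mathrm{fin}}$ is realized as the operators $V_k$ with $k$ in the $L^1(0,T)$-closure of $\operatorname{span}\{h_\beta:\beta\in\Gamma,\beta>0\}$. *)

theory Defs
  imports "HOL-Analysis.Analysis"
begin

text \<open>Elements of \<open>L\<^sup>1(0,T)\<close> are represented by functions on the whole line of which only the
  values on \<open>(0,T)\<close> matter; they are identified when they agree almost everywhere there.\<close>

definition L1 :: "real \<Rightarrow> (real \<Rightarrow> complex) set" where
  "L1 T = {f. set_integrable lebesgue {0<..<T} f}"

definition L1_norm :: "real \<Rightarrow> (real \<Rightarrow> complex) \<Rightarrow> real" where
  "L1_norm T f = (LINT t:{0<..<T}|lebesgue. norm (f t))"

type_synonym operator = "(real \<Rightarrow> complex) \<Rightarrow> real \<Rightarrow> complex"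

definition volterra :: "(real \<Rightarrow> complex) \<Rightarrow> operator" where
  "volterra k f t = (LINT s:{0<..<t}|lebesgue. k (t - s) * f s)"

text \<open>\<open>A\<close> and \<open>V\<^sub>k\<close> coincide as operators on \<open>L\<^sup>1(0,T)\<close>; the kernel \<open>k\<close> is then determined by
  \<open>A\<close> up to a null set.\<close>

definition has_kernel :: "real \<Rightarrow> operator \<Rightarrow> (real \<Rightarrow> complex) \<Rightarrow> bool" where
  "has_kernel T A k \<longleftrightarrow> k \<in> L1 T \<and>
     (\<forall>f\<in>L1 T. AE t\<in>{0<..<T} in lebesgue. A f t = volterra k f t)"

definition convolution_operator :: "real \<Rightarrow> operator \<Rightarrow> bool" where
  "convolution_operator T A \<longleftrightarrow> (\<exists>k. has_kernel T A k)"

text \<open>Only meaningful for convolution operators.\<close>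

definition kernel_norm :: "real \<Rightarrow> operator \<Rightarrow> real" where
  "kernel_norm T A = (THE r. \<exists>k. has_kernel T A k \<and> r = L1_norm T k)"

definition frac_kernel :: "real \<Rightarrow> real \<Rightarrow> complex" where
  "frac_kernel \<beta> t = of_real (t powr (\<beta> - 1) / Gamma \<beta>)"

definition frac_integral :: "real \<Rightarrow> operator" where
  "frac_integral \<beta> = volterra (frac_kernel \<beta>)"

definition frac_kernel_span :: "real set \<Rightarrow> (real \<Rightarrow> complex) set" where
  "frac_kernel_span G =
     {(\<lambda>t. \<Sum>\<beta>\<in>F. c \<beta> * frac_kernel \<beta> t) | F c. finite F \<and> F \<subseteq> {\<beta> \<in> G. \<beta> > 0}}"

definition L1_closure :: "real \<Rightarrow> (real \<Rightarrow> complex) set \<Rightarrow> (real \<Rightarrow> complex) set" where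
  "L1_closure T K = {k \<in> L1 T. \<forall>\<epsilon>>0. \<exists>p \<in> K \<inter> L1 T. L1_norm T (\<lambda>t. k t - p t) < \<epsilon>}"

text \<open>The kernel-norm completion of the complex span of the fractional integrals of positive order
  in \<open>G\<close>, realized inside the convolution operators on \<open>L\<^sup>1(0,T)\<close>.\<close>

definition kernel_completion :: "real set \<Rightarrow> real \<Rightarrow> operator set" where
  "kernel_completion G T = {A. \<exists>k \<in> L1_closure T (frac_kernel_span G). has_kernel T A k}"

text \<open>The series \<open>\<Sum>n. A n\<close> of convolution operators converges absolutely in the kernel norm
  on \<open>(0,T)\<close>, and its sum is the convolution operator \<open>B\<close>.\<close>

definition kernel_abs_sums :: "real \<Rightarrow> (nat \<Rightarrow> operator) \<Rightarrow> operator \<Rightarrow> bool" where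
  "kernel_abs_sums T A B \<longleftrightarrow>
     (\<forall>n. convolution_operator T (A n)) \<and> convolution_operator T B \<and>
     summable (\<lambda>n. kernel_norm T (A n)) \<and>
     (\<lambda>N. kernel_norm T (\<lambda>f t. B f t - (\<Sum>n<N. A n f t))) \<longlonglongrightarrow> 0"

definition mittag_leffler3 :: "real \<Rightarrow> real \<Rightarrow> complex \<Rightarrow> complex \<Rightarrow> complex" where
  "mittag_leffler3 \<rho> \<mu> \<gamma> z =
     (\<Sum>n. pochhammer \<gamma> n / (fact n * of_real (Gamma (\<rho> * real n + \<mu>))) * z ^ n)"

definition prabhakar :: "real \<Rightarrow> real \<Rightarrow> complex \<Rightarrow> complex \<Rightarrow> operator" where
  "prabhakar \<rho> \<mu> \<omega> \<gamma> f t =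
     (LINT s:{0<..<t}|lebesgue.
        of_real ((t - s) powr (\<mu> - 1)) *
        mittag_leffler3 \<rho> \<mu> \<gamma> (\<omega> * of_real ((t - s) powr \<rho>)) * f s)"

end

theory Submission
  imports Defs
begin

text \<open>Substituting \<open>z = \<omega> t powr \<rho>\<close> in the Mittag-Leffler series writes the Prabhakar kernel, for
  \<open>t > 0\<close>, as the series of the terms \<open>(\<gamma>)\<^sub>n \<omega>\<^sup>n / n!\<close> times \<open>h\<^bsub>\<mu> + \<rho> n\<^esub>\<close>. Two facts turn this
  pointwise identity into the identity of operators.

  The first is that the series converges absolutely in \<open>L\<^sup>1(0,T)\<close>. The norm of \<open>h\<^bsub>\<beta>\<^esub>\<close> is
  \<open>T powr \<beta> / \<Gamma>(\<beta> + 1)\<close>, so everything depends on \<open>\<Gamma>(\<rho> n + \<mu>)\<close> growing faster than every geometric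
  sequence. Instead of Stirling's formula, Euler's integral cut off at \<open>R\<close> is enough: it gives
  \<open>\<Gamma>(x) \<ge> R powr (x - 1) e\<^sup>-\<^sup>R\<close> for each \<open>R\<close>
  (\<open>Gamma_ge_powr_times_exp\<close>), and \<open>R\<close> may be as large as the geometric sequence requires. The same
  estimate yields pointwise convergence, and dominated convergence then identifies the
  pointwise sum with the \<open>L\<^sup>1\<close> sum (\<open>L1_norm_partial_sums\<close>).

  The second is that kernels may be computed with: each remainder of the operator series
  has the corresponding remainder of the kernel series as its kernel, and the kernel norm is the \<open>L\<^sup>1\<close> norm of any
  kernel. The former is linearity of \<open>k \<mapsto> V\<^sub>k\<close>, which needs the integral defining \<open>V\<^sub>k f\<close> to
  converge absolutely almost everywhere; this is Tonelli's theorem for convolutions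
  (\<open>AE_volterra_integrable\<close>). The latter is uniqueness of the kernel (\<open>has_kernel_unique\<close>):
  \<open>V\<^sub>k 1\<close> is the primitive of \<open>k\<close>, which determines \<open>k\<close> by Lebesgue's differentiation theorem.

  Membership in the completion is the same convergence, because the partial sums lie in the span:
  each order \<open>\<mu> + \<rho> n\<close> belongs to the group.\<close>

section \<open>Growth of the gamma function\<close>

text \<open>On \<open>t \<ge> R\<close> the factor \<open>t powr (x - 1)\<close> of Euler's integrand is at least \<open>R powr (x - 1)\<close>, and
  the integral of \<open>e\<^sup>-\<^sup>t\<close> over that half-line is \<open>e\<^sup>-\<^sup>R\<close>.\<close>

lemma Gamma_ge_powr_times_exp:
  fixes x R :: real
  assumes "x \<ge> 1" "R > 0"
  shows "R powr (x - 1) * exp (- R) \<le> Gamma x"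
proof -
  have G: "((\<lambda>t. t powr (x - 1) / exp t) has_integral Gamma x) {0..}"
    using assms by (intro Gamma_integral_real) auto
  have E: "((\<lambda>t. R powr (x - 1) * exp (- 1 * t)) has_integral R powr (x - 1) * (exp (- 1 * R) / 1)) {R..}"
    by (intro has_integral_mult_right has_integral_exp_minus_to_infinity) auto
  have E0: "((\<lambda>t. if t \<in> {R..} then R powr (x - 1) * exp (- 1 * t) else 0) has_integral
      R powr (x - 1) * (exp (- 1 * R) / 1)) {0..}"
    using E assms by (subst has_integral_restrict) auto
  have "R powr (x - 1) * (exp (- 1 * R) / 1) \<le> Gamma x"
  proof (rule has_integral_le[OF E0 G])
    fix t :: real assume "t \<in> {0..}"
    show "(if t \<in> {R..} then R powr (x - 1) * exp (- 1 * t) else 0) \<le> t powr (x - 1) / exp t"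
      using assms by (auto simp: exp_minus field_simps intro!: powr_mono2)
  qed
  then show ?thesis by simp
qed

lemma norm_pochhammer_div_fact_le:
  fixes a :: complex
  shows "norm (pochhammer a n / fact n) \<le> (1 + norm a) ^ n"
proof (induction n)
  case (Suc n)
  have "norm (a + of_nat n) \<le> norm a + real n"
    using norm_triangle_ineq[of a "of_nat n"] by simp
  also have "\<dots> \<le> (1 + norm a) * real (Suc n)"
    by (simp add: algebra_simps)
  finally have "norm (a + of_nat n) / real (Suc n) \<le> 1 + norm a"
    by (simp add: divide_le_eq)
  then have "norm (pochhammer a n / fact n) * (norm (a + of_nat n) / real (Suc n)) \<le> (1 + norm a) ^ n * (1 + norm a)"
    by (intro mult_mono Suc) auto
  moreover have "norm (pochhammer a (Suc n) / fact (Suc n))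
      = norm (pochhammer a n / fact n) * (norm (a + of_nat n) / real (Suc n))"
    by (simp add: pochhammer_Suc norm_mult norm_divide mult.commute del: of_nat_Suc)
  ultimately show ?case by (simp add: mult.commute)
qed simp

text \<open>The numerators grow at most like powers of \<open>y = (1 + |a|) x\<close>. The lower bound on the gamma
  function, with \<open>R\<close> chosen so that \<open>R powr \<rho>\<close> exceeds \<open>2 y\<close>, beats them by a factor
  \<open>2\<^sup>n\<close>.\<close>

lemma summable_pochhammer_power_div_Gamma:
  fixes a :: complex and x \<rho> \<mu> :: real
  assumes "\<rho> > 0" "\<mu> > 0" "x \<ge> 0"
  shows "summable (\<lambda>n. norm (pochhammer a n / fact n) * x ^ n / Gamma (\<rho> * real n + \<mu>))"
proof -
  define y where "y = (1 + norm a) * x"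
  \<comment> \<open>The summand 1 ensures \<open>R \<ge> 1\<close>, also for \<open>y = 0\<close>, so that powers of \<open>R\<close> increase with
    the exponent.\<close>
  define R where "R = (2 * y + 1) powr (1 / \<rho>)"
  have y: "y \<ge> 0" using assms by (simp add: y_def)
  have R: "R \<ge> 1" "R powr \<rho> = 2 * y + 1"
    using y assms by (auto simp: R_def powr_powr ge_one_powr_ge_zero)
  have le: "norm (norm (pochhammer a n / fact n) * x ^ n / Gamma (\<rho> * real n + \<mu>)) \<le> R * exp R * (1/2) ^ n"
    if n: "\<rho> * real n + \<mu> \<ge> 1" for n
  proof -
    have "(R powr \<rho>) ^ n / R * exp (- R) \<le> R powr (\<rho> * real n + \<mu> - 1) * exp (- R)"
    proof -
      have "(R powr \<rho>) ^ n / R = R powr (\<rho> * real n - 1)"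
        using R(1) by (simp add: powr_diff powr_powr flip: powr_realpow)
      also have "\<dots> \<le> R powr (\<rho> * real n + \<mu> - 1)"
        using R assms by (intro powr_mono) auto
      finally show ?thesis by (intro mult_right_mono) auto
    qed
    also have "\<dots> \<le> Gamma (\<rho> * real n + \<mu>)"
      using Gamma_ge_powr_times_exp[OF n, of R] R by simp
    finally have G: "(2 * y + 1) ^ n / (R * exp R) \<le> Gamma (\<rho> * real n + \<mu>)"
      by (simp add: R exp_minus field_simps)
    have "norm (pochhammer a n / fact n) * x ^ n \<le> y ^ n"
      using assms unfolding y_def power_mult_distrib
      by (intro mult_right_mono norm_pochhammer_div_fact_le) auto
    also have "\<dots> \<le> ((2 * y + 1) / 2) ^ n"
      using y by (intro power_mono) auto
    also have "\<dots> = R * exp R * (1/2) ^ n * ((2 * y + 1) ^ n / (R * exp R))"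
      using R by (simp add: power_divide)
    also have "\<dots> \<le> R * exp R * (1/2) ^ n * Gamma (\<rho> * real n + \<mu>)"
      using R G by (intro mult_left_mono) auto
    finally have "norm (pochhammer a n / fact n) * x ^ n / Gamma (\<rho> * real n + \<mu>) \<le> R * exp R * (1/2) ^ n"
      using n by (simp add: divide_le_eq Gamma_real_pos)
    moreover have "Gamma (\<rho> * real n + \<mu>) > 0"
      using n by (intro Gamma_real_pos) auto
    ultimately show ?thesis using assms
      by simp
  qed
  \<comment> \<open>The bound for the gamma function is restricted to arguments \<open>\<ge> 1\<close>; only finitely many
    arguments \<open>\<rho> n + \<mu>\<close> are smaller.\<close>
  have "eventually (\<lambda>n. \<rho> * real n + \<mu> \<ge> 1) sequentially"
  proof -
    obtain N where N: "real N \<ge> 1 / \<rho>" using real_arch_simple by blast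
    have "\<rho> * real n + \<mu> \<ge> 1" if "n \<ge> N" for n
    proof -
      have "1 / \<rho> \<le> real n" using N that by linarith
      then show ?thesis using assms by (simp add: divide_le_eq mult.commute)
    qed
    then show ?thesis by (auto simp: eventually_sequentially)
  qed
  then have "eventually (\<lambda>n. norm (norm (pochhammer a n / fact n) * x ^ n / Gamma (\<rho> * real n + \<mu>))
      \<le> R * exp R * (1/2) ^ n) sequentially"
    by (rule eventually_mono) (rule le)
  moreover have "summable (\<lambda>n. R * exp R * (1/2) ^ n)"
    by (intro summable_mult summable_geometric) auto
  ultimately show ?thesis
    by (rule summable_comparison_test_ev)
qed

section \<open>Absolutely convergent series of integrable functions\<close>

lemma L1_add: "f \<in> L1 T \<Longrightarrow> g \<in> L1 T \<Longrightarrow> (\<lambda>t. f t + g t) \<in> L1 T"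
  unfolding L1_def by (auto intro: set_integral_add)

lemma L1_cmult: "f \<in> L1 T \<Longrightarrow> (\<lambda>t. c * f t) \<in> L1 T"
  unfolding L1_def by auto

lemma L1_zero: "(\<lambda>t. 0) \<in> L1 T"
  unfolding L1_def by (simp add: set_integrable_def)

lemma L1_diff: "f \<in> L1 T \<Longrightarrow> g \<in> L1 T \<Longrightarrow> (\<lambda>t. f t - g t) \<in> L1 T"
  unfolding L1_def by (auto intro: set_integral_diff)

lemma L1_sum: "(\<And>n. n \<in> I \<Longrightarrow> f n \<in> L1 T) \<Longrightarrow> (\<lambda>t. \<Sum>n\<in>I. f n t) \<in> L1 T"
  by (induction I rule: infinite_finite_induct) (auto intro: L1_zero L1_add)

text \<open>The sum of the norms of the terms is integrable because the \<open>L\<^sup>1\<close> norms are summable, and it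
  dominates every remainder; the remainders tend to 0 pointwise, hence also in norm.\<close>

lemma
  fixes u :: "nat \<Rightarrow> real \<Rightarrow> complex"
  assumes u: "\<And>n. u n \<in> L1 T"
    and pt: "\<And>t. 0 < t \<Longrightarrow> t < T \<Longrightarrow> summable (\<lambda>n. norm (u n t))"
    and nrm: "summable (\<lambda>n. L1_norm T (u n))"
  shows L1_suminf: "(\<lambda>t. \<Sum>n. u n t) \<in> L1 T"
    and L1_norm_partial_sums: "(\<lambda>N. L1_norm T (\<lambda>t. (\<Sum>n. u n t) - (\<Sum>n<N. u n t))) \<longlonglongrightarrow> 0"
proof -
  define v where "v n t = indicator {0<..<T} t *\<^sub>R u n t" for n t
  have v: "integrable lebesgue (v n)" for n
    using u[of n] unfolding L1_def v_def set_integrable_def by simp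
  have pv: "summable (\<lambda>n. norm (v n t))" for t
    using pt[of t] by (cases "t \<in> {0<..<T}") (auto simp: v_def)
  have nv: "L1_norm T (u n) = (\<integral>t. norm (v n t) \<partial>lebesgue)" for n
    unfolding L1_norm_def v_def set_lebesgue_integral_def by simp
  have sv: "(\<Sum>n. v n t) = indicator {0<..<T} t *\<^sub>R (\<Sum>n. u n t)" for t
    by (auto simp: v_def indicator_def)
  have int: "integrable lebesgue (\<lambda>t. \<Sum>n. v n t)"
    using pv nrm by (intro integrable_suminf v) (auto simp: nv)
  show "(\<lambda>t. \<Sum>n. u n t) \<in> L1 T"
    using int unfolding sv L1_def set_integrable_def by simp
  have dom: "integrable lebesgue (\<lambda>t. \<Sum>n. norm (v n t))"
    using pv nrm by (intro integrable_suminf integrable_norm v) (auto simp: nv)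
  have "(\<lambda>N. \<integral>t. norm ((\<Sum>n. v n t) - (\<Sum>n<N. v n t)) \<partial>lebesgue) \<longlonglongrightarrow> integral\<^sup>L lebesgue (\<lambda>t::real. 0)"
  proof (rule integral_dominated_convergence[OF _ _ dom])
    show "(\<lambda>t. norm ((\<Sum>n. v n t) - (\<Sum>n<N. v n t))) \<in> borel_measurable lebesgue" for N
      using int v by (intro borel_measurable_integrable integrable_norm Bochner_Integration.integrable_diff Bochner_Integration.integrable_sum)
    show "AE t in lebesgue. (\<lambda>N. norm ((\<Sum>n. v n t) - (\<Sum>n<N. v n t))) \<longlonglongrightarrow> 0"
    proof (rule AE_I2)
      fix t
      have "(\<lambda>N. \<Sum>n<N. v n t) \<longlonglongrightarrow> (\<Sum>n. v n t)"
        using summable_norm_cancel[OF pv] by (rule summable_LIMSEQ)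
      from tendsto_norm[OF tendsto_diff[OF tendsto_const[of "\<Sum>n. v n t"] this]]
      show "(\<lambda>N. norm ((\<Sum>n. v n t) - (\<Sum>n<N. v n t))) \<longlonglongrightarrow> 0" by simp
    qed
    show "AE t in lebesgue. norm (norm ((\<Sum>n. v n t) - (\<Sum>n<N. v n t))) \<le> (\<Sum>n. norm (v n t))" for N
    proof (rule AE_I2)
      fix t
      have "(\<Sum>n. v n t) - (\<Sum>n<N. v n t) = (\<Sum>n. v (n + N) t)"
        using suminf_split_initial_segment[OF summable_norm_cancel[OF pv], of t N] by simp
      also have "norm \<dots> \<le> (\<Sum>n. norm (v (n + N) t))"
        using summable_ignore_initial_segment[OF pv[of t], of N] by (rule summable_norm)
      also have "\<dots> = (\<Sum>n. norm (v n t)) - (\<Sum>n<N. norm (v n t))"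
        using suminf_split_initial_segment[OF pv, of t N] by simp
      also have "\<dots> \<le> (\<Sum>n. norm (v n t))"
        by (simp add: sum_nonneg)
      finally show "norm (norm ((\<Sum>n. v n t) - (\<Sum>n<N. v n t))) \<le> (\<Sum>n. norm (v n t))" by simp
    qed
  qed simp
  moreover have "L1_norm T (\<lambda>t. (\<Sum>n. u n t) - (\<Sum>n<N. u n t))
      = (\<integral>t. norm ((\<Sum>n. v n t) - (\<Sum>n<N. v n t)) \<partial>lebesgue)" for N
    unfolding L1_norm_def set_lebesgue_integral_def
    by (rule Bochner_Integration.integral_cong) (auto simp: v_def indicator_def)
  ultimately show "(\<lambda>N. L1_norm T (\<lambda>t. (\<Sum>n. u n t) - (\<Sum>n<N. u n t))) \<longlonglongrightarrow> 0"
    by simp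
qed

section \<open>The kernel of a convolution operator is unique\<close>

text \<open>Testing an operator on the constant function 1 recovers the primitive of its kernel.\<close>

lemma volterra_const_one: "volterra k (\<lambda>_. 1) t = (LINT s:{0<..<t}|lebesgue. k s)"
proof -
  have "(LINT s:{0<..<t}|lebesgue. k s) = (\<integral>s. indicator {0<..<t} (t + (-1) * s) *\<^sub>R k (t + (-1) * s) \<partial>lebesgue)"
    unfolding set_lebesgue_integral_def
    by (subst lebesgue_integral_real_affine[where c = "-1" and t = t]) auto
  also have "\<dots> = volterra k (\<lambda>_. 1) t"
    unfolding volterra_def set_lebesgue_integral_def
    by (rule Bochner_Integration.integral_cong) (auto simp: indicator_def)
  finally show ?thesis by simp
qed

text \<open>By Lebesgue's differentiation theorem \<open>g x\<close> is, for almost every \<open>x\<close>, the limit of the averages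
  of \<open>g\<close> over \<open>{x..y}\<close> as \<open>y\<close> decreases to \<open>x\<close>. The primitive vanishes only almost everywhere, but the points \<open>y\<close>
  where it does come arbitrarily close to \<open>x\<close>, and for them the average is 0.\<close>

lemma AE_eq_0_if_primitive_AE_eq_0:
  fixes g :: "real \<Rightarrow> complex"
  assumes g: "g \<in> L1 T"
    and zero: "AE t\<in>{0<..<T} in lebesgue. (LINT s:{0<..<t}|lebesgue. g s) = 0"
  shows "AE t\<in>{0<..<T} in lebesgue. g t = 0"
proof -
  define h where "h t = indicator {0<..<T} t *\<^sub>R g t" for t
  have h: "integrable lebesgue h"
    using g unfolding L1_def set_integrable_def h_def by simp
  have hs: "set_integrable lebesgue A h" if "A \<in> sets lebesgue" for A
    using integrable_mult_indicator[OF that h] by (simp add: set_integrable_def)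
  have hi: "h integrable_on cbox a b" for a b
    using hs[of "cbox a b"] by (intro set_lebesgue_integral_eq_integral(1)) auto
  obtain N where N: "negligible N"
    "\<And>x e. x \<notin> N \<Longrightarrow> 0 < e \<Longrightarrow> \<exists>d>0. \<forall>r. 0 < r \<and> r < d \<longrightarrow>
        norm (integral (cbox x (x + r *\<^sub>R One)) h /\<^sub>R r ^ DIM(real) - h x) < e"
    using integrable_ccontinuous_explicit[OF hi] by metis
  obtain Z where Z: "\<And>t. t \<in> space lebesgue - Z \<Longrightarrow> t \<in> {0<..<T} \<longrightarrow> (LINT s:{0<..<t}|lebesgue. g s) = 0"
      "Z \<in> null_sets lebesgue"
    using AE_E3[OF zero] by blast
  have prim: "integral {0..t} h = 0" if "t \<in> {0<..<T} - Z" for t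
  proof -
    have "integral {0..t} h = (LINT s:{0..t}|lebesgue. h s)"
      using hs[of "{0..t}"] by (simp add: set_lebesgue_integral_eq_integral(2))
    also have "\<dots> = (LINT s:{0<..<t}|lebesgue. g s)"
      unfolding set_lebesgue_integral_def
    proof (rule integral_cong_AE)
      show "(\<lambda>s. indicator {0..t} s *\<^sub>R h s) \<in> borel_measurable lebesgue"
        using hs[of "{0..t}"] by (auto simp: set_integrable_def)
      have "(\<lambda>s. indicator {0<..<t} s *\<^sub>R h s) = (\<lambda>s. indicator {0<..<t} s *\<^sub>R g s)"
        using that by (auto simp: h_def indicator_def)
      then show "(\<lambda>s. indicator {0<..<t} s *\<^sub>R g s) \<in> borel_measurable lebesgue"
        using hs[of "{0<..<t}"] by (auto simp: set_integrable_def)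
      have "AE s in lebesgue. s \<noteq> t"
        by (intro AE_completion AE_lborel_singleton)
      then show "AE s in lebesgue. indicator {0..t} s *\<^sub>R h s = indicator {0<..<t} s *\<^sub>R g s"
        by eventually_elim (use that in \<open>auto simp: h_def indicator_def\<close>)
    qed
    also have "\<dots> = 0" using Z that by auto
    finally show ?thesis .
  qed
  have "h x = 0" if x: "x \<in> {0<..<T}" "x \<notin> N \<union> Z" for x
  proof (rule ccontr)
    assume "h x \<noteq> 0"
    then obtain d where d: "d > 0" "\<And>r. 0 < r \<Longrightarrow> r < d \<Longrightarrow>
        norm (integral {x..x + r} h /\<^sub>R r - h x) < norm (h x)"
      using N(2)[of x "norm (h x)"] x by auto
    \<comment> \<open>A null set contains no interval, so some point just to the right of \<open>x\<close> avoids
      \<open>Z\<close>.\<close>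
    define m where "m = min (x + d) T"
    have m: "x < m" using x d by (auto simp: m_def)
    have "\<not> {x<..<m} \<subseteq> Z"
    proof
      assume "{x<..<m} \<subseteq> Z"
      then have "negligible {x<..<m}"
        using Z(2) negligible_iff_null_sets negligible_subset by blast
      then show False using m open_not_negligible[of "{x<..<m}"] by auto
    qed
    then obtain y where "y \<in> {x<..<m}" and yZ: "y \<notin> Z" by blast
    then have y: "x < y" "y < x + d" "y < T" by (auto simp: m_def)
    have "integral {0..x} h + integral {x..y} h = integral {0..y} h"
      using x y hi[of 0 y] by (intro Henstock_Kurzweil_Integration.integral_combine) auto
    then have "integral {x..y} h = 0"
      using prim[of x] prim[of y] x y yZ by auto
    then show False using d(2)[of "y - x"] y by auto
  qed
  moreover have "N \<union> Z \<in> null_sets lebesgue"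
    using negligible_Un[of N Z] N(1) Z(2) by (simp add: negligible_iff_null_sets)
  ultimately show ?thesis
    by (intro AE_I'[of "N \<union> Z"]) (auto simp: h_def)
qed

lemma has_kernel_unique:
  assumes "has_kernel T A k" "has_kernel T A l"
  shows "AE t\<in>{0<..<T} in lebesgue. k t = l t"
proof -
  have kl: "k \<in> L1 T" "l \<in> L1 T" using assms by (auto simp: has_kernel_def)
  have one: "(\<lambda>_. 1) \<in> L1 T"
    unfolding L1_def mem_Collect_eq
    by (rule set_integrable_subset[OF absolutely_integrable_continuous_real[of 0 T]]) auto
  have "AE t\<in>{0<..<T} in lebesgue. A (\<lambda>_. 1) t = volterra k (\<lambda>_. 1) t"
       "AE t\<in>{0<..<T} in lebesgue. A (\<lambda>_. 1) t = volterra l (\<lambda>_. 1) t"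
    using assms one unfolding has_kernel_def by blast+
  then have "AE t\<in>{0<..<T} in lebesgue. (LINT s:{0<..<t}|lebesgue. k s - l s) = 0"
  proof eventually_elim
    case (elim t)
    show ?case
    proof
      assume t: "t \<in> {0<..<T}"
      then have "{0<..<t} \<subseteq> {0<..<T}" by auto
      then have "set_integrable lebesgue {0<..<t} k" "set_integrable lebesgue {0<..<t} l"
        using kl by (auto simp: L1_def elim!: set_integrable_subset)
      then have "(LINT s:{0<..<t}|lebesgue. k s - l s) = (LINT s:{0<..<t}|lebesgue. k s) - (LINT s:{0<..<t}|lebesgue. l s)"
        by (rule set_integral_diff(2))
      moreover have "volterra k (\<lambda>_. 1) t = volterra l (\<lambda>_. 1) t"
        using elim t by metis
      ultimately show "(LINT s:{0<..<t}|lebesgue. k s - l s) = 0"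
        by (simp add: volterra_const_one)
    qed
  qed
  from AE_eq_0_if_primitive_AE_eq_0[OF L1_diff[OF kl] this] show ?thesis
    by eventually_elim simp
qed

lemma L1_norm_cong_AE:
  assumes "k \<in> L1 T" "l \<in> L1 T" "AE t\<in>{0<..<T} in lebesgue. k t = l t"
  shows "L1_norm T k = L1_norm T l"
proof -
  have "(\<lambda>t. norm (indicator {0<..<T} t *\<^sub>R k t)) \<in> borel_measurable lebesgue" if "k \<in> L1 T" for k
    using that unfolding L1_def set_integrable_def mem_Collect_eq
    by (rule borel_measurable_integrable[OF integrable_norm])
  note meas = this[OF assms(1)] this[OF assms(2)]
  have "AE t in lebesgue. norm (indicator {0<..<T} t *\<^sub>R k t) = norm (indicator {0<..<T} t *\<^sub>R l t)"
    using assms(3) by eventually_elim (auto simp: indicator_def)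
  with meas have "(\<integral>t. norm (indicator {0<..<T} t *\<^sub>R k t) \<partial>lebesgue) = (\<integral>t. norm (indicator {0<..<T} t *\<^sub>R l t) \<partial>lebesgue)"
    by (rule integral_cong_AE)
  then show ?thesis
    unfolding L1_norm_def set_lebesgue_integral_def by simp
qed

text \<open>This justifies the definite description in the definition of the kernel norm.\<close>

lemma kernel_norm_eq:
  assumes "has_kernel T A k"
  shows "kernel_norm T A = L1_norm T k"
  unfolding kernel_norm_def
proof (rule the_equality)
  show "\<exists>l. has_kernel T A l \<and> L1_norm T k = L1_norm T l" using assms by blast
  fix r assume "\<exists>l. has_kernel T A l \<and> r = L1_norm T l"
  then obtain l where l: "has_kernel T A l" "r = L1_norm T l" by blast
  have "L1_norm T l = L1_norm T k"
  proof (rule L1_norm_cong_AE)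
    show "l \<in> L1 T" "k \<in> L1 T" using l(1) assms unfolding has_kernel_def by blast+
  qed (rule has_kernel_unique[OF l(1) assms])
  with l(2) show "r = L1_norm T k" by simp
qed

section \<open>Linearity of the kernel\<close>

lemma integrable_lebesgue_cong_AE:
  fixes f g :: "real \<Rightarrow> complex"
  assumes "integrable lebesgue f" "AE x in lebesgue. f x = g x"
  shows "integrable lebesgue g"
proof -
  obtain N where N: "\<And>x. x \<in> space lebesgue - N \<Longrightarrow> f x = g x" "N \<in> null_sets lebesgue"
    using AE_E3[OF assms(2)] by blast
  have "f absolutely_integrable_on UNIV"
    using assms(1) by (simp add: set_integrable_def)
  then have "g absolutely_integrable_on UNIV"
    by (rule absolutely_integrable_spike[where S = N]) (use N in \<open>auto simp: negligible_iff_null_sets\<close>)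
  then show ?thesis by (simp add: set_integrable_def)
qed

text \<open>Fubini's theorem needs a product of \<open>\<sigma>\<close>-algebras with respect to which \<open>(s, t) \<mapsto> k (t - s)\<close> is
  measurable. The product of the Lebesgue \<open>\<sigma>\<close>-algebras is too small for this, so functions are first
  replaced by Borel versions.\<close>

lemma integrable_lebesgue_Borel_version:
  fixes f :: "real \<Rightarrow> complex"
  assumes f: "integrable lebesgue f"
  obtains g where "integrable lborel g" "AE x in lborel. f x = g x"
proof -
  have "(\<lambda>x. Re (f x)) \<in> borel_measurable lebesgue" "(\<lambda>x. Im (f x)) \<in> borel_measurable lebesgue"
    using borel_measurable_integrable[OF f] by measurable
  from this[THEN completion_ex_borel_measurable_real]
  obtain a b where [measurable]: "a \<in> borel_measurable lborel" "b \<in> borel_measurable lborel"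
    and ab: "AE x in lborel. Re (f x) = a x" "AE x in lborel. Im (f x) = b x"
    by blast
  define g where "g x = Complex (a x) (b x)" for x
  have [measurable]: "g \<in> borel_measurable lborel"
    unfolding g_def Complex_eq by measurable
  have fg: "AE x in lborel. f x = g x"
    using ab by eventually_elim (simp add: g_def complex_eq_iff)
  have "integrable lebesgue g"
    using integrable_lebesgue_cong_AE[OF f AE_completion[OF fg]] .
  then have "integrable lborel g"
    by (simp add: integrable_completion)
  with fg show thesis using that by blast
qed

text \<open>Integrating \<open>|k (t - s) f s|\<close> over \<open>t\<close> first gives the norm of \<open>k\<close> times \<open>|f s|\<close>, by translation
  invariance. So the double integral is finite, and hence so is almost every integral over
  \<open>s\<close>.\<close>

lemma AE_convolution_integrable:
  fixes k f :: "real \<Rightarrow> complex"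
  assumes k: "integrable lborel k" and f: "integrable lborel f"
  shows "AE t in lborel. integrable lborel (\<lambda>s. k (t - s) * f s)"
proof -
  have [measurable]: "k \<in> borel_measurable borel" "f \<in> borel_measurable borel"
    using k f by (auto dest: borel_measurable_integrable)
  have kt: "integrable lborel (\<lambda>t. k (t - s))" "(\<integral>t. norm (k (t - s)) \<partial>lborel) = (\<integral>t. norm (k t) \<partial>lborel)" for s
    using lborel_integrable_real_affine[OF k, of 1 "- s"]
      lborel_integral_real_affine[of 1 "\<lambda>t. norm (k t)" "- s"] by (simp_all add: algebra_simps)
  have "integrable (lborel \<Otimes>\<^sub>M lborel) (\<lambda>(s, t). k (t - s) * f s)"
  proof (rule lborel_pair.Fubini_integrable)
    show "AE s in lborel. integrable lborel (\<lambda>t. case (s, t) of (s, t) \<Rightarrow> k (t - s) * f s)"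
      using kt(1) by (auto intro!: integrable_mult_left)
    show "integrable lborel (\<lambda>s. \<integral>t. norm (case (s, t) of (s, t) \<Rightarrow> k (t - s) * f s) \<partial>lborel)"
      using f kt(2) by (simp add: norm_mult)
  qed measurable
  from lborel_pair.AE_integrable_snd[OF this] show ?thesis by simp
qed

text \<open>Extending \<open>k\<close> and \<open>f\<close> by zero outside \<open>(0,T)\<close> reduces this to convolution on the line: if
  \<open>0 < s < t < T\<close>, then \<open>s\<close> and \<open>t - s\<close> both lie in \<open>(0,T)\<close>, where the extensions agree with
  \<open>k\<close> and \<open>f\<close>.\<close>

lemma AE_volterra_integrable:
  assumes k: "k \<in> L1 T" and f: "f \<in> L1 T"
  shows "AE t\<in>{0<..<T} in lebesgue. set_integrable lebesgue {0<..<t} (\<lambda>s. k (t - s) * f s)"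
proof -
  obtain K where K: "integrable lborel K" "AE t in lborel. indicator {0<..<T} t *\<^sub>R k t = K t"
  proof (rule integrable_lebesgue_Borel_version)
    show "integrable lebesgue (\<lambda>t. indicator {0<..<T} t *\<^sub>R k t)"
      using k by (simp add: L1_def set_integrable_def)
  qed
  obtain F where F: "integrable lborel F" "AE t in lborel. indicator {0<..<T} t *\<^sub>R f t = F t"
  proof (rule integrable_lebesgue_Borel_version)
    show "integrable lebesgue (\<lambda>t. indicator {0<..<T} t *\<^sub>R f t)"
      using f by (simp add: L1_def set_integrable_def)
  qed
  have [measurable]: "K \<in> borel_measurable borel" "F \<in> borel_measurable borel"
    using K F by (auto dest: borel_measurable_integrable)
  obtain N where N: "\<And>t. t \<in> space lborel - N \<Longrightarrow> indicator {0<..<T} t *\<^sub>R k t = K t"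
      "N \<in> null_sets lborel"
    using AE_E3[OF K(2)] by blast
  \<comment> \<open>For fixed \<open>t\<close> the reflection \<open>s \<mapsto> t - s\<close> preserves null sets, so the Borel version of \<open>k\<close> may
    be used under the integral sign for every \<open>t\<close>.\<close>
  have AEN: "AE s in lborel. t - s \<notin> N" for t
  proof -
    have "AE s in lborel. t + (-1) * s \<notin> N"
      using N(2) AE_not_in[OF N(2)] by (intro AE_borel_affine[where P = "\<lambda>x. x \<notin> N"]) (auto simp: pred_def)
    then show ?thesis by simp
  qed
  have "AE t in lebesgue. integrable lborel (\<lambda>s. K (t - s) * F s)"
    by (intro AE_completion AE_convolution_integrable K F)
  then show ?thesis
  proof eventually_elim
    case (elim t)
    show ?case
    proof
      assume t: "t \<in> {0<..<T}"
      have "integrable lebesgue (\<lambda>s. K (t - s) * F s)"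
        using elim by (subst integrable_completion) auto
      then have "integrable lebesgue (\<lambda>s. indicator {0<..<t} s *\<^sub>R (K (t - s) * F s))"
        by (intro integrable_mult_indicator) auto
      moreover have "AE s in lebesgue. indicator {0<..<t} s *\<^sub>R (K (t - s) * F s) = indicator {0<..<t} s *\<^sub>R (k (t - s) * f s)"
      proof (rule AE_completion)
        from AEN[of t] F(2) show "AE s in lborel. indicator {0<..<t} s *\<^sub>R (K (t - s) * F s) = indicator {0<..<t} s *\<^sub>R (k (t - s) * f s)"
        proof eventually_elim
          case (elim s)
          have "indicator {0<..<T} (t - s) *\<^sub>R k (t - s) = K (t - s)" using elim N(1)[of "t - s"] by simp
          then show ?case using elim t by (auto simp: indicator_def split: if_splits)
        qed
      qed
      ultimately show "set_integrable lebesgue {0<..<t} (\<lambda>s. k (t - s) * f s)"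
        unfolding set_integrable_def
        by (rule integrable_lebesgue_cong_AE)
    qed
  qed
qed

lemma has_kernel_add:
  assumes "has_kernel T A k" "has_kernel T B l"
  shows "has_kernel T (\<lambda>f t. A f t + B f t) (\<lambda>t. k t + l t)"
  unfolding has_kernel_def
proof (intro conjI ballI)
  have kl: "k \<in> L1 T" "l \<in> L1 T" using assms by (auto simp: has_kernel_def)
  then show "(\<lambda>t. k t + l t) \<in> L1 T" by (rule L1_add)
  fix f assume f: "f \<in> L1 T"
  then have "AE t\<in>{0<..<T} in lebesgue. A f t = volterra k f t"
    "AE t\<in>{0<..<T} in lebesgue. B f t = volterra l f t"
    using assms by (auto simp: has_kernel_def)
  with AE_volterra_integrable[OF kl(1) f] AE_volterra_integrable[OF kl(2) f]
  show "AE t\<in>{0<..<T} in lebesgue. A f t + B f t = volterra (\<lambda>t. k t + l t) f t"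
    by eventually_elim (auto simp: volterra_def ring_distribs)
qed

lemma volterra_cmult: "volterra (\<lambda>t. c * k t) f t = c * volterra k f t"
  unfolding volterra_def by (simp add: mult.assoc)

lemma has_kernel_cmult:
  assumes "has_kernel T A k"
  shows "has_kernel T (\<lambda>f t. c * A f t) (\<lambda>t. c * k t)"
  unfolding has_kernel_def volterra_cmult
proof (intro conjI ballI)
  show "(\<lambda>t. c * k t) \<in> L1 T" using assms by (auto simp: has_kernel_def intro: L1_cmult)
  fix f assume "f \<in> L1 T"
  with assms have "AE t\<in>{0<..<T} in lebesgue. A f t = volterra k f t"
    by (simp add: has_kernel_def)
  then show "AE t\<in>{0<..<T} in lebesgue. c * A f t = c * volterra k f t"
    by eventually_elim simp
qed

lemma has_kernel_volterra: "k \<in> L1 T \<Longrightarrow> has_kernel T (volterra k) k"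
  by (simp add: has_kernel_def)

lemma has_kernel_sum:
  assumes "\<And>n. n \<in> I \<Longrightarrow> has_kernel T (A n) (k n)"
  shows "has_kernel T (\<lambda>f t. \<Sum>n\<in>I. A n f t) (\<lambda>t. \<Sum>n\<in>I. k n t)"
  using assms
proof (induction I rule: infinite_finite_induct)
  case (insert n I)
  then show ?case using has_kernel_add[of T "A n" "k n"] by simp
qed (auto simp: has_kernel_def L1_zero volterra_def)

lemma has_kernel_diff:
  assumes "has_kernel T A k" "has_kernel T B l"
  shows "has_kernel T (\<lambda>f t. A f t - B f t) (\<lambda>t. k t - l t)"
  using has_kernel_add[OF assms(1) has_kernel_cmult[OF assms(2), of "- 1"]] by simp

text \<open>Convergence of operators in the kernel norm reduces to convergence of their kernels in
  \<open>L\<^sup>1\<close>.\<close>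

lemma kernel_abs_sumsI:
  assumes u: "\<And>n. u n \<in> L1 T"
    and pt: "\<And>t. 0 < t \<Longrightarrow> t < T \<Longrightarrow> summable (\<lambda>n. norm (u n t))"
    and nrm: "summable (\<lambda>n. L1_norm T (u n))"
    and A: "\<And>n. has_kernel T (A n) (u n)"
    and B: "has_kernel T B (\<lambda>t. \<Sum>n. u n t)"
  shows "kernel_abs_sums T A B"
proof -
  have "has_kernel T (\<lambda>f t. B f t - (\<Sum>n<N. A n f t)) (\<lambda>t. (\<Sum>n. u n t) - (\<Sum>n<N. u n t))" for N
    by (intro has_kernel_diff has_kernel_sum A B)
  note R = kernel_norm_eq[OF this]
  show ?thesis
    using A B nrm L1_norm_partial_sums[OF u pt nrm]
    unfolding kernel_abs_sums_def convolution_operator_def R kernel_norm_eq[OF A] by blast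
qed

section \<open>The Prabhakar kernel\<close>

lemma
  assumes "\<beta> > 0" "T > 0"
  shows frac_kernel_L1: "frac_kernel \<beta> \<in> L1 T"
    and L1_norm_frac_kernel: "L1_norm T (frac_kernel \<beta>) = T powr \<beta> / Gamma (\<beta> + 1)"
proof -
  have G: "Gamma \<beta> > 0" using assms by (simp add: Gamma_real_pos)
  have I: "((\<lambda>t. t powr (\<beta> - 1) / Gamma \<beta>) has_integral T powr \<beta> / \<beta> / Gamma \<beta>) {0..T}"
    using has_integral_divide[OF has_integral_powr_from_0[of "\<beta> - 1" T]] assms by simp
  then have "((\<lambda>t. t powr (\<beta> - 1) / Gamma \<beta>) has_integral T powr \<beta> / \<beta> / Gamma \<beta>) {0<..<T}"
    by (simp add: has_integral_Icc_iff_Ioo)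
  note I = this
  have A: "set_integrable lebesgue {0<..<T} (\<lambda>t. t powr (\<beta> - 1) / Gamma \<beta>)"
    using I G by (intro nonnegative_absolutely_integrable_1) (auto simp: has_integral_iff)
  then show "frac_kernel \<beta> \<in> L1 T"
    unfolding L1_def frac_kernel_def set_integrable_def
    by (auto dest!: integrable_of_real[where 'a = complex] simp: scaleR_conv_of_real)
  have "L1_norm T (frac_kernel \<beta>) = (LINT t:{0<..<T}|lebesgue. t powr (\<beta> - 1) / Gamma \<beta>)"
    unfolding L1_norm_def frac_kernel_def using G by (simp add: norm_divide)
  also have "\<dots> = T powr \<beta> / \<beta> / Gamma \<beta>"
    using set_lebesgue_integral_eq_integral(2)[OF A] integral_unique[OF I] by (rule trans)
  also have "\<dots> = T powr \<beta> / Gamma (\<beta> + 1)"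
    using assms by (subst Gamma_plus1) (auto elim!: nonpos_Ints_cases)
  finally show "L1_norm T (frac_kernel \<beta>) = T powr \<beta> / Gamma (\<beta> + 1)" .
qed

lemma L1_norm_cmult: "L1_norm T (\<lambda>t. c * k t) = norm c * L1_norm T k"
  by (simp add: L1_norm_def norm_mult)

definition prabhakar_term :: "real \<Rightarrow> real \<Rightarrow> complex \<Rightarrow> complex \<Rightarrow> nat \<Rightarrow> real \<Rightarrow> complex" where
  "prabhakar_term \<rho> \<mu> \<omega> \<gamma> n t =
     pochhammer \<gamma> n * \<omega> ^ n / fact n * frac_kernel (\<mu> + \<rho> * real n) t"

context
  fixes \<rho> \<mu> :: real
  assumes \<rho>: "\<rho> > 0" and \<mu>: "\<mu> > 0"
begin

lemma order_pos: "\<mu> + \<rho> * real n > 0"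
  using \<rho> \<mu> by (intro add_pos_nonneg) auto

lemma Gamma_order_pos: "Gamma (\<rho> * real n + \<mu>) > 0"
  using order_pos[of n] by (intro Gamma_real_pos) (simp add: add.commute)

lemma prabhakar_term_eq:
  assumes t: "t > 0"
  shows "prabhakar_term \<rho> \<mu> \<omega> \<gamma> n t = of_real (t powr (\<mu> - 1)) *
     (pochhammer \<gamma> n / (fact n * of_real (Gamma (\<rho> * real n + \<mu>))) * (\<omega> * of_real (t powr \<rho>)) ^ n)"
proof -
  have "t powr (\<mu> + \<rho> * real n - 1) = t powr (\<mu> - 1) * t powr (\<rho> * real n)"
    using powr_add[of t "\<mu> - 1" "\<rho> * real n"] by (simp only: diff_add_eq)
  also have "t powr (\<rho> * real n) = (t powr \<rho>) ^ n"
    using t powr_realpow[of "t powr \<rho>" n] by (simp only: powr_powr powr_gt_zero)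
  finally have "t powr (\<mu> + \<rho> * real n - 1) = t powr (\<mu> - 1) * (t powr \<rho>) ^ n" .
  then show ?thesis
    unfolding prabhakar_term_def frac_kernel_def add.commute[of "\<rho> * real n" \<mu>]
    by (simp add: power_mult_distrib)
qed

lemma summable_mittag_leffler3:
  fixes \<gamma> z :: complex
  shows
  "summable (\<lambda>n. norm (pochhammer \<gamma> n / (fact n * of_real (Gamma (\<rho> * real n + \<mu>))) * z ^ n))"
proof -
  have "norm (pochhammer \<gamma> n / (fact n * of_real (Gamma (\<rho> * real n + \<mu>))) * z ^ n)
      = norm (pochhammer \<gamma> n / fact n) * norm z ^ n / Gamma (\<rho> * real n + \<mu>)" for n
    using Gamma_order_pos[of n] by (simp add: norm_mult norm_divide norm_power)
  then have eq: "(\<lambda>n. norm (pochhammer \<gamma> n / (fact n * of_real (Gamma (\<rho> * real n + \<mu>))) * z ^ n))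
      = (\<lambda>n. norm (pochhammer \<gamma> n / fact n) * norm z ^ n / Gamma (\<rho> * real n + \<mu>))"
    by (rule ext)
  show ?thesis
    unfolding eq by (rule summable_pochhammer_power_div_Gamma[OF \<rho> \<mu> norm_ge_zero])
qed

lemma summable_norm_prabhakar_term:
  assumes "t > 0"
  shows "summable (\<lambda>n. norm (prabhakar_term \<rho> \<mu> \<omega> \<gamma> n t))"
  unfolding prabhakar_term_eq[OF assms]
  by (subst norm_mult) (rule summable_mult[OF summable_mittag_leffler3])

lemma suminf_prabhakar_term:
  assumes "t > 0"
  shows "(\<Sum>n. prabhakar_term \<rho> \<mu> \<omega> \<gamma> n t) =
    of_real (t powr (\<mu> - 1)) * mittag_leffler3 \<rho> \<mu> \<gamma> (\<omega> * of_real (t powr \<rho>))"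
  unfolding prabhakar_term_eq[OF assms] mittag_leffler3_def
  by (rule suminf_mult[OF summable_norm_cancel[OF summable_mittag_leffler3]])

lemma prabhakar_eq_volterra:
  "prabhakar \<rho> \<mu> \<omega> \<gamma> f t = volterra (\<lambda>t. \<Sum>n. prabhakar_term \<rho> \<mu> \<omega> \<gamma> n t) f t"
  unfolding prabhakar_def volterra_def
  by (rule set_lebesgue_integral_cong) (auto simp: suminf_prabhakar_term)

lemma prabhakar_term_L1: "T > 0 \<Longrightarrow> prabhakar_term \<rho> \<mu> \<omega> \<gamma> n \<in> L1 T"
  unfolding prabhakar_term_def by (intro L1_cmult frac_kernel_L1 order_pos)

lemma summable_L1_norm_prabhakar_term:
  assumes "T > 0"
  shows "summable (\<lambda>n. L1_norm T (prabhakar_term \<rho> \<mu> \<omega> \<gamma> n))"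
proof -
  \<comment> \<open>Up to a constant factor these norms are the terms of the Mittag-Leffler series at \<open>|\<omega>| T powr \<rho>\<close>,
    with \<open>\<mu> + 1\<close> in place of \<open>\<mu>\<close> and the coefficients \<open>(\<gamma>)\<^sub>n\<close> replaced by their absolute values.\<close>
  have "L1_norm T (prabhakar_term \<rho> \<mu> \<omega> \<gamma> n) = T powr \<mu> * (norm (pochhammer \<gamma> n / fact n) *
     (norm \<omega> * T powr \<rho>) ^ n / Gamma (\<rho> * real n + (\<mu> + 1)))" for n
  proof -
    have "T powr (\<mu> + \<rho> * real n) = T powr \<mu> * (T powr \<rho>) ^ n"
      using assms by (simp add: powr_add powr_powr flip: powr_realpow)
    then show ?thesis
      using assms order_pos[of n]
      unfolding prabhakar_term_def L1_norm_cmult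
      by (simp add: L1_norm_frac_kernel norm_mult norm_divide norm_power power_mult_distrib add_ac)
  qed
  moreover have "summable (\<lambda>n. T powr \<mu> * (norm (pochhammer \<gamma> n / fact n) *
     (norm \<omega> * T powr \<rho>) ^ n / Gamma (\<rho> * real n + (\<mu> + 1))))"
    using \<rho> \<mu> by (intro summable_mult summable_pochhammer_power_div_Gamma) auto
  ultimately show ?thesis by presburger
qed

text \<open>The span is indexed by sets of orders, not by \<open>n\<close>. Since \<open>\<rho> > 0\<close>, distinct \<open>n\<close> give distinct
  orders, so the coefficients can be read off from the order.\<close>

lemma partial_sum_in_frac_kernel_span:
  assumes "\<And>n. \<mu> + \<rho> * real n \<in> G"
  shows "(\<lambda>t. \<Sum>n<N. prabhakar_term \<rho> \<mu> \<omega> \<gamma> n t) \<in> frac_kernel_span G"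
proof -
  define b where "b n = \<mu> + \<rho> * real n" for n
  define c where "c n = pochhammer \<gamma> n * \<omega> ^ n / fact n" for n
  have inj: "inj b" using \<rho> by (auto simp: inj_def b_def)
  have "(\<Sum>n<N. prabhakar_term \<rho> \<mu> \<omega> \<gamma> n t) = (\<Sum>\<beta>\<in>b ` {..<N}. c (inv b \<beta>) * frac_kernel \<beta> t)" for t
    using inj by (subst sum.reindex) (auto simp: inj_on_def inj_def prabhakar_term_def b_def[symmetric] c_def[symmetric])
  moreover have "b ` {..<N} \<subseteq> {\<beta> \<in> G. \<beta> > 0}"
    using assms order_pos by (auto simp: b_def)
  ultimately show ?thesis
    unfolding frac_kernel_span_def by (intro CollectI exI[of _ "b ` {..<N}"] exI[of _ "c \<circ> inv b"]) auto
qed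

end

theorem proposition5:
  fixes T :: real and G :: "real set" and \<rho> \<mu> :: real and \<gamma> \<omega> :: complex
  assumes "T > 0"
    and G_add: "\<And>x y. x \<in> G \<Longrightarrow> y \<in> G \<Longrightarrow> x + y \<in> G"
    and G_minus: "\<And>x. x \<in> G \<Longrightarrow> - x \<in> G"
    and G_Ints: "\<int> \<subseteq> G"
    and "\<rho> > 0" and "\<mu> > 0"
    and "\<rho> \<in> G" and "\<mu> \<in> G"
  shows "prabhakar \<rho> \<mu> \<omega> \<gamma> \<in> kernel_completion G T \<and>
    (\<forall>S>0. kernel_abs_sums S
       (\<lambda>n f t. pochhammer \<gamma> n * \<omega> ^ n / fact n * frac_integral (\<mu> + \<rho> * real n) f t)
       (prabhakar \<rho> \<mu> \<omega> \<gamma>))"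
proof (intro conjI allI impI)
  let ?u = "prabhakar_term \<rho> \<mu> \<omega> \<gamma>"
  note rm = \<open>\<rho> > 0\<close> \<open>\<mu> > 0\<close>
  have L1: "(\<lambda>t. \<Sum>n. ?u n t) \<in> L1 S" if "S > 0" for S
    using that by (intro L1_suminf prabhakar_term_L1 summable_norm_prabhakar_term
        summable_L1_norm_prabhakar_term rm)
  have B: "has_kernel S (prabhakar \<rho> \<mu> \<omega> \<gamma>) (\<lambda>t. \<Sum>n. ?u n t)" if "S > 0" for S
    using L1[OF that] by (simp add: has_kernel_def prabhakar_eq_volterra[OF rm])
  show "kernel_abs_sums S
       (\<lambda>n f t. pochhammer \<gamma> n * \<omega> ^ n / fact n * frac_integral (\<mu> + \<rho> * real n) f t)
       (prabhakar \<rho> \<mu> \<omega> \<gamma>)" if S: "S > 0" for S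
  proof (rule kernel_abs_sumsI[where u = ?u])
    show "has_kernel S (\<lambda>f t. pochhammer \<gamma> n * \<omega> ^ n / fact n * frac_integral (\<mu> + \<rho> * real n) f t) (?u n)" for n
      unfolding prabhakar_term_def frac_integral_def
      by (intro has_kernel_cmult has_kernel_volterra frac_kernel_L1 order_pos rm S)
  qed (use S in \<open>auto intro: prabhakar_term_L1 summable_norm_prabhakar_term
        summable_L1_norm_prabhakar_term rm B\<close>)
  have "\<mu> + \<rho> * real n \<in> G" for n
  proof (induction n)
    case (Suc n)
    then show ?case using G_add[OF Suc \<open>\<rho> \<in> G\<close>] by (simp add: algebra_simps)
  qed (use \<open>\<mu> \<in> G\<close> in simp)
  note span = partial_sum_in_frac_kernel_span[OF rm this]
  have "(\<lambda>t. \<Sum>n. ?u n t) \<in> L1_closure T (frac_kernel_span G)"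
    unfolding L1_closure_def
  proof (intro CollectI conjI allI impI L1 \<open>T > 0\<close>)
    fix \<epsilon> :: real assume "\<epsilon> > 0"
    have "(\<lambda>N. L1_norm T (\<lambda>t. (\<Sum>n. ?u n t) - (\<Sum>n<N. ?u n t))) \<longlonglongrightarrow> 0"
      using \<open>T > 0\<close> by (intro L1_norm_partial_sums prabhakar_term_L1 summable_norm_prabhakar_term
        summable_L1_norm_prabhakar_term rm)
    from order_tendstoD(2)[OF this \<open>\<epsilon> > 0\<close>]
    obtain N where "L1_norm T (\<lambda>t. (\<Sum>n. ?u n t) - (\<Sum>n<N. ?u n t)) < \<epsilon>"
      by (auto dest: eventually_happens)
    moreover have "(\<lambda>t. \<Sum>n<N. ?u n t) \<in> L1 T"
      using \<open>T > 0\<close> by (intro L1_sum prabhakar_term_L1 rm)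
    ultimately show "\<exists>p\<in>frac_kernel_span G \<inter> L1 T. L1_norm T (\<lambda>t. (\<Sum>n. ?u n t) - p t) < \<epsilon>"
      using span[where N = N and \<omega> = \<omega> and \<gamma> = \<gamma>]
      by (intro bexI[where x = "\<lambda>t. \<Sum>n<N. ?u n t"] IntI)
  qed
  then show "prabhakar \<rho> \<mu> \<omega> \<gamma> \<in> kernel_completion G T"
    unfolding kernel_completion_def using B[OF \<open>T > 0\<close>] by blast
qed

end
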